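(* Let $G$ be a topological group containing a subspace homeomorphic to the Sorgenfrey line. Then $G$ contains a discrete subspace of cardinality $\mathfrak{c}=2^{\aleph_0}$ (the cardinality of the continuum).
   Context: The Sorgenfrey line is the set of real numbers $\mathbb{R}$ endowed with the topology generated by the half-intervals $[a,b)$, where $a<b$ are arbitrary real numbers. A subspace $D$ of a topological space is discrete if its subspace topology is discrete (it need not be closed). *)

theory Defs
  imports "HOL-Analysis.Analysis"
begin

definition sorgenfrey_line :: "real topology"
  where "sorgenfrey_line = topology_generated_by {{a..<b} | a b. a < b}"

lemma topspace_sorgenfrey_line [simp]: "topspace sorgenfrey_line = UNIV"
proof -
  have "x \<in> {x..<x + 1}" "x < x + 1" for x :: real
    by auto
  then show ?thesis
    unfolding sorgenfrey_line_def topology_generated_by_topspace by blast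
qed

end

theory Submission
  imports Defs
begin

text \<open>
  Let \<open>h\<close> be the embedding of the Sorgenfrey line. The antidiagonal \<open>{(x, -x)}\<close> is a discrete
  subset of the square of the Sorgenfrey line, because a basic neighbourhood of \<open>(x, -x)\<close>
  only allows both coordinates to grow. The sum \<open>h x + h (-x)\<close> inherits this, at least locally in
  \<open>x\<close>. If \<open>y \<ge> x\<close> is close to \<open>x\<close> and \<open>h y + h (-y)\<close> is close to
  \<open>h x + h (-x)\<close>, then cancelling \<open>h y\<close>, which is close to \<open>h x\<close>, shows that \<open>h (-y)\<close> is close
  to \<open>h (-x)\<close>; hence \<open>-y \<ge> -x\<close> and \<open>y = x\<close>. For \<open>y \<le> x\<close> one cancels \<open>h (-y)\<close> instead. Thus
  each \<open>x\<close> has some \<open>e x > 0\<close> such that \<open>h x + h (-x)\<close> has a neighbourhood containing no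
  \<open>h y + h (-y)\<close> with \<open>0 < \<bar>y - x\<bar> < e x\<close> (lemma \<open>antidiagonal_sum_isolated\<close>).

  It remains to find continuum many points, any two of them closer to each other than their values
  of \<open>e\<close>. Countably many sets with this property cover the line: bound \<open>e\<close> from below by \<open>1/(n+1)\<close>
  and cut into intervals of length \<open>1/(n+1)\<close>. Since the continuum has uncountable cofinality, one
  of these sets has the size of the continuum (lemma \<open>countable_colouring_of_reals\<close>). The sums over
  that set are pairwise distinct and form a discrete subspace.
\<close>

section \<open>Uncountable cofinality of the continuum\<close>

text \<open>
  A real codes a set of natural numbers, a pairing function splits that set into countably many
  sections, and each section codes one term of the sequence.
\<close>
lemma real_sequences_image_of_reals:
  obtains d :: "real \<Rightarrow> ('i::countable \<Rightarrow> real)" where "surj d"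
proof -
  obtain e :: "real \<Rightarrow> nat set" where "bij e"
    using nat_sets_eqpoll_reals eqpoll_sym unfolding eqpoll_def by blast
  then have "surj e"
    by (rule bij_is_surj)
  define d :: "real \<Rightarrow> ('i \<Rightarrow> real)"
    where "d r = (\<lambda>i. inv e {k. prod_encode (to_nat i, k) \<in> e r})" for r
  have "\<exists>r. f = d r" for f
  proof -
    obtain r where r: "e r = {m. \<exists>i k. m = prod_encode (to_nat i, k) \<and> k \<in> e (f i)}"
      using surjD[OF \<open>surj e\<close>] by (metis (no_types, lifting))
    have "d r = f"
      using inv_f_f[OF bij_is_inj[OF \<open>bij e\<close>]] by (simp add: d_def r)
    then show ?thesis
      by blast
  qed
  then show thesis
    using that by blast
qed

text \<open>
  Koenig's diagonal argument. If no colour class maps onto the reals, then for each colour \<open>i\<close>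
  some real is not an \<open>i\<close>-th coordinate of the sequences coded by the class of \<open>i\<close>, and the sequence
  of these reals has a code without a colour.
\<close>
lemma countable_colouring_of_reals:
  fixes c :: "real \<Rightarrow> 'i::countable"
  obtains i where "{x. c x = i} \<approx> (UNIV :: real set)"
proof (rule ccontr)
  assume none: "\<not> thesis"
  obtain d :: "real \<Rightarrow> ('i \<Rightarrow> real)" where "surj d"
    by (rule real_sequences_image_of_reals)
  have "\<exists>r. r \<notin> (\<lambda>x. d x i) ` {x. c x = i}" for i
  proof (rule ccontr)
    assume "\<nexists>r. r \<notin> (\<lambda>x. d x i) ` {x. c x = i}"
    then have "(UNIV :: real set) \<lesssim> {x. c x = i}"
      by (intro subset_image_lepoll[where f = "\<lambda>x. d x i"]) blast
    then have "{x. c x = i} \<approx> (UNIV :: real set)"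
      by (rule lepoll_antisym[OF subset_imp_lepoll[OF subset_UNIV]])
    then show False
      using none that by blast
  qed
  then obtain f where f: "\<And>i. f i \<notin> (\<lambda>x. d x i) ` {x. c x = i}"
    by metis
  obtain x where "d x = f"
    using \<open>surj d\<close> by (metis surjD)
  then show False
    using f[of "c x"] by blast
qed

section \<open>Embeddings of the Sorgenfrey line\<close>

lemma openin_sorgenfrey_line_contains_half_interval:
  assumes "openin sorgenfrey_line U" and "x \<in> U"
  shows "\<exists>e>0. {x..<x + e} \<subseteq> U"
proof -
  have "generate_topology_on {{a..<b} | a b :: real. a < b} U"
    using assms(1) unfolding sorgenfrey_line_def openin_topology_generated_by_iff .
  then have "\<forall>x\<in>U. \<exists>e>0. {x..<x + e} \<subseteq> U"
  proof induction
    case (Int U V)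
    show ?case
    proof
      fix x assume "x \<in> U \<inter> V"
      then obtain e e' where "e > 0" "{x..<x + e} \<subseteq> U" "e' > 0" "{x..<x + e'} \<subseteq> V"
        using Int.IH by blast
      then show "\<exists>e>0. {x..<x + e} \<subseteq> U \<inter> V"
        by (intro exI[of _ "min e e'"]) (auto simp: subset_eq)
    qed
  next
    case (UN K)
    then show ?case
      by (meson Sup_upper UnionE order_trans)
  next
    case (Basis s)
    then obtain a b where s: "s = {a..<b}"
      by blast
    show ?case
    proof
      fix x assume "x \<in> s"
      then show "\<exists>e>0. {x..<x + e} \<subseteq> s"
        by (intro exI[of _ "b - x"]) (auto simp: s)
    qed
  qed simp
  then show ?thesis
    using assms(2) by blast
qed

text \<open>
  The two properties of an embedding that matter: points slightly to the right of \<open>x\<close> go near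
  \<open>h x\<close>, whereas points to the left of \<open>x\<close> stay away from \<open>h x\<close>.
\<close>
definition sorgenfrey_like :: "(real \<Rightarrow> 'a::topological_space) \<Rightarrow> bool"
  where "sorgenfrey_like h \<longleftrightarrow>
    (\<forall>x A. open A \<longrightarrow> h x \<in> A \<longrightarrow> (\<exists>e>0. \<forall>y. x \<le> y \<longrightarrow> y < x + e \<longrightarrow> h y \<in> A)) \<and>
    (\<forall>x. \<exists>N. open N \<and> h x \<in> N \<and> (\<forall>y. h y \<in> N \<longrightarrow> x \<le> y))"

lemma sorgenfrey_like_parametrisation:
  fixes S :: "'a::topological_space set"
  assumes "top_of_set S homeomorphic_space sorgenfrey_line"
  obtains h :: "real \<Rightarrow> 'a" where "sorgenfrey_like h"
proof -
  obtain g h where "homeomorphic_maps (top_of_set S) sorgenfrey_line g h"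
    using assms unfolding homeomorphic_space_def by blast
  then have g: "continuous_map (top_of_set S) sorgenfrey_line g"
    and h: "continuous_map sorgenfrey_line (top_of_set S) h"
    and gh: "\<And>x. g (h x) = x"
    unfolding homeomorphic_maps_def by auto
  have hS: "h x \<in> S" for x
    using continuous_map_image_subset_topspace[OF h] by auto
  have "\<exists>e>0. \<forall>y. x \<le> y \<longrightarrow> y < x + e \<longrightarrow> h y \<in> A" if "open A" "h x \<in> A" for x A
  proof -
    have "openin sorgenfrey_line {y. h y \<in> S \<inter> A}"
      using openin_continuous_map_preimage[OF h openin_open_Int[OF \<open>open A\<close>]] by simp
    then obtain e where "e > 0" "{x..<x + e} \<subseteq> {y. h y \<in> S \<inter> A}"
      using openin_sorgenfrey_line_contains_half_interval hS \<open>h x \<in> A\<close> by blast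
    then show ?thesis
      by (intro exI[of _ e]) (auto simp: subset_eq)
  qed
  moreover have "\<exists>N. open N \<and> h x \<in> N \<and> (\<forall>y. h y \<in> N \<longrightarrow> x \<le> y)" for x
  proof -
    have "openin sorgenfrey_line {x..<x + 1}"
      unfolding sorgenfrey_line_def
      by (intro topology_generated_by_Basis CollectI exI[of _ x] exI[of _ "x + 1"]) simp
    from openin_continuous_map_preimage[OF g this]
    obtain N where "open N" and N: "{s \<in> S. g s \<in> {x..<x + 1}} = S \<inter> N"
      by (auto simp: openin_open)
    have "h y \<in> N \<longleftrightarrow> y \<in> {x..<x + 1}" for y
      using eqset_imp_iff[OF N, of "h y"] hS[of y] gh[of y] by simp
    with \<open>open N\<close> show ?thesis
      by (intro exI[of _ N]) auto
  qed
  ultimately show thesis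
    using that[of h] unfolding sorgenfrey_like_def by blast
qed

section \<open>Isolating the sums along the antidiagonal\<close>

text \<open>
  Here \<open>F\<close> recovers \<open>h (-t)\<close> from \<open>h t\<close> and \<open>s t\<close>. If \<open>t \<ge> x\<close> is close to \<open>x\<close> and \<open>s t\<close> is close
  to \<open>s x\<close>, then continuity puts \<open>h (-t)\<close> close to \<open>h (-x)\<close>, which forces \<open>-t \<ge> -x\<close>.
  Left and right cancellation in a noncommutative group are two instances of \<open>F\<close>.
\<close>
lemma isolated_from_the_right:
  fixes h s :: "real \<Rightarrow> 'a::topological_space"
  assumes "sorgenfrey_like h"
    and "continuous_on UNIV F"
    and F: "\<And>t. F (h t, s t) = h (-t)"
  obtains e W where "e > 0" "open W" "s x \<in> W" "\<And>y. x < y \<Longrightarrow> y < x + e \<Longrightarrow> s y \<notin> W"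
proof -
  obtain N where "open N" "h (-x) \<in> N" and N: "\<And>y. h y \<in> N \<Longrightarrow> -x \<le> y"
    using assms(1) unfolding sorgenfrey_like_def by blast
  have "open (F -` N)"
    using \<open>open N\<close> assms(2) by (rule open_vimage)
  moreover have "(h x, s x) \<in> F -` N"
    using F \<open>h (-x) \<in> N\<close> by simp
  ultimately obtain A W where "open A" "open W" "(h x, s x) \<in> A \<times> W" and AW: "A \<times> W \<subseteq> F -` N"
    by (rule open_prod_elim)
  then obtain e where "e > 0" and e: "\<And>y. x \<le> y \<Longrightarrow> y < x + e \<Longrightarrow> h y \<in> A"
    using assms(1) unfolding sorgenfrey_like_def by blast
  have "s y \<notin> W" if "x < y" "y < x + e" for y
  proof
    assume "s y \<in> W"
    then have "h (-y) \<in> N"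
      using e[of y] that AW F[of y] by auto
    then show False
      using N[of "-y"] \<open>x < y\<close> by simp
  qed
  then show thesis
    using that[of e W] \<open>e > 0\<close> \<open>open W\<close> \<open>(h x, s x) \<in> A \<times> W\<close> by blast
qed

text \<open>
  Reflecting \<open>t\<close> to \<open>-t\<close> exchanges the two summands, so isolation from the left at \<open>x\<close> is
  isolation from the right at \<open>-x\<close> for the reflected sums.
\<close>
lemma antidiagonal_sum_isolated:
  fixes h :: "real \<Rightarrow> 'a::topological_group_add"
  assumes "sorgenfrey_like h"
  obtains e W where "e > 0" "open W" "h x + h (-x) \<in> W"
    "\<And>y. y \<noteq> x \<Longrightarrow> \<bar>y - x\<bar> < e \<Longrightarrow> h y + h (-y) \<notin> W"
proof -
  have "continuous_on UNIV (\<lambda>p :: 'a \<times> 'a. - fst p + snd p)"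
    by (intro continuous_intros)
  then obtain e W where R: "e > 0" "open W" "h x + h (-x) \<in> W"
    "\<And>y. x < y \<Longrightarrow> y < x + e \<Longrightarrow> h y + h (-y) \<notin> W"
    by (rule isolated_from_the_right[OF assms, where s = "\<lambda>t. h t + h (-t)" and x = x])
      (simp_all add: add.assoc[symmetric])
  have "continuous_on UNIV (\<lambda>p :: 'a \<times> 'a. snd p - fst p)"
    by (intro continuous_intros)
  then obtain e' W' where L: "e' > 0" "open W'" "h (- (-x)) + h (-x) \<in> W'"
    "\<And>y. -x < y \<Longrightarrow> y < -x + e' \<Longrightarrow> h (-y) + h y \<notin> W'"
    by (rule isolated_from_the_right[OF assms, where s = "\<lambda>t. h (-t) + h t" and x = "-x"])
      simp_all
  have "h y + h (-y) \<notin> W \<inter> W'" if "y \<noteq> x" "\<bar>y - x\<bar> < min e e'" for y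
    using R(4)[of y] L(4)[of "-y"] that by (cases "x < y") auto
  then show thesis
    using that[of "min e e'" "W \<inter> W'"] R L by auto
qed

section \<open>A discrete subspace of the size of the continuum\<close>

theorem theorem1:
  fixes S :: "'a::topological_group_add set"
  assumes "top_of_set S homeomorphic_space sorgenfrey_line"
  shows "\<exists>D :: 'a set. top_of_set D = discrete_topology D \<and> D \<approx> (UNIV :: real set)"
proof -
  obtain h :: "real \<Rightarrow> 'a" where "sorgenfrey_like h"
    using assms by (rule sorgenfrey_like_parametrisation)
  define d where "d x = h x + h (-x)" for x
  have "\<exists>e W. e > 0 \<and> open W \<and> d x \<in> W \<and> (\<forall>y. y \<noteq> x \<longrightarrow> \<bar>y - x\<bar> < e \<longrightarrow> d y \<notin> W)" for x
    unfolding d_def by (rule antidiagonal_sum_isolated[OF \<open>sorgenfrey_like h\<close>, of x]) blast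
  then obtain e W where e: "\<And>x. e x > 0" and W: "\<And>x. open (W x)" "\<And>x. d x \<in> W x"
    and isolated: "\<And>x y. y \<noteq> x \<Longrightarrow> \<bar>y - x\<bar> < e x \<Longrightarrow> d y \<notin> W x"
    by metis
  have "\<exists>n. inverse (real (Suc n)) < e x" for x
    using reals_Archimedean[OF e[of x]] .
  then obtain n where n: "\<And>x. inverse (real (Suc (n x))) < e x"
    by metis
  obtain i where large: "{x. (n x, \<lfloor>x * real (Suc (n x))\<rfloor>) = i} \<approx> (UNIV :: real set)"
    by (rule countable_colouring_of_reals)
  obtain m k where i: "i = (m, k)"
    by (rule prod.exhaust)
  \<comment> \<open>On this class every \<open>e x\<close> exceeds \<open>1/(m+1)\<close>, and the class lies in one interval of that length.\<close>
  define X where "X = {x. (n x, \<lfloor>x * real (Suc (n x))\<rfloor>) = (m, k)}"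
  have close: "\<bar>y - x\<bar> < e x" if "x \<in> X" "y \<in> X" for x y
  proof -
    have "\<lfloor>x * real (Suc m)\<rfloor> = \<lfloor>y * real (Suc m)\<rfloor>"
      using that by (auto simp: X_def)
    then have "\<bar>y * real (Suc m) - x * real (Suc m)\<bar> < 1"
      by linarith
    then have "\<bar>y - x\<bar> * real (Suc m) < 1"
      by (simp add: abs_mult flip: left_diff_distrib)
    then have "\<bar>y - x\<bar> < inverse (real (Suc m))"
      by (simp add: field_simps)
    also have "\<dots> < e x"
      using n[of x] \<open>x \<in> X\<close> by (simp add: X_def)
    finally show ?thesis .
  qed
  have only: "y = x" if "x \<in> X" "y \<in> X" "d y \<in> W x" for x y
    using isolated[of y x] close that by blast
  have "inj_on d X"
    using only W(2) by (metis inj_onI)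
  then have "d ` X \<approx> (UNIV :: real set)"
    using large eqpoll_trans[OF inj_on_image_eqpoll_self] unfolding X_def i by blast
  moreover have "top_of_set (d ` X) = discrete_topology (d ` X)"
  proof -
    have "openin (top_of_set (d ` X)) {d x}" if "x \<in> X" for x
    proof -
      have "{d x} = d ` X \<inter> W x"
        using only W(2) that by blast
      then show ?thesis
        using W(1) by (metis openin_open_Int)
    qed
    then have "discrete_topology (d ` X) = top_of_set (d ` X)"
      unfolding discrete_topology_unique by auto
    then show ?thesis ..
  qed
  ultimately show ?thesis
    by blast
qed

end
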